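(* Let $r(x)=\sum_{n\ge 0}x^{2^n-1}$, $B(x)=1-xr(x)$, $h_n=H_n(B(x))$, and $g_n=H_n\!\left(\frac{1-r(x)}{x}\right)$. Then $h_0=h_1=1$, $h_2=-2$, and for each $n\ge 3$, $$h_n=(-1)^n\,(h_m+g_{m-1}),$$ where $k$ is the integer with $2^k<n\le 2^{k+1}$ and $m=2^{k+1}-n+1$.
   Context: For a power series $f(x)=\sum_{i\ge 0}a_ix^i$ and $n\ge 1$, $H_n(f)=\det(a_{i+j})_{0\le i,j\le n-1}$, $H_0(f)=1$. *)

theory Defs
  imports
    "HOL-Computational_Algebra.Formal_Power_Series"
    "Jordan_Normal_Form.Determinant"
begin

text \<open>The matrix of size \<open>0\<close> has determinant \<open>1\<close>, so \<open>hankel_det 0 f = 1\<close>.\<close>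

definition hankel_det :: "nat \<Rightarrow> 'a::comm_ring_1 fps \<Rightarrow> 'a" where
  "hankel_det n f = det (mat n n (\<lambda>(i, j). fps_nth f (i + j)))"

lemma hankel_det_0: "hankel_det 0 f = 1"
  by (simp add: hankel_det_def)

text \<open>The infinite sum is taken in the \<open>x\<close>-adic topology of formal power series.
  The coefficients are in an arbitrary field of characteristic \<open>0\<close>, so that the quotient
  \<open>(1 - r) / x\<close> can be written with the division of power series.\<close>

definition r_series :: "'a::field_char_0 fps" where
  "r_series = (\<Sum>n. fps_X ^ (2 ^ n - 1))"

lemma r_series_sums_aux:
  "(\<lambda>n. fps_X ^ (2 ^ n - 1)) sums
     (Abs_fps (\<lambda>i. if \<exists>n. i = 2 ^ n - 1 then 1 else 0) :: 'a::field_char_0 fps)"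
  unfolding sums_def
proof (rule tendsto_fpsI)
  fix i :: nat
  have inj: "a = b" if "(2::nat) ^ a - 1 = 2 ^ b - 1" for a b :: nat
  proof -
    have "(0::nat) < 2 ^ a" "(0::nat) < 2 ^ b" by simp_all
    with that have "(2::nat) ^ a = 2 ^ b" by linarith
    then show ?thesis by simp
  qed
  have "(\<Sum>n<N. fps_nth (fps_X ^ (2 ^ n - 1) :: 'a fps) i) =
          (if \<exists>n. i = 2 ^ n - 1 then 1 else 0)" if "N > i" for N
  proof (cases "\<exists>n. i = 2 ^ n - 1")
    case True
    then obtain n where n: "i = 2 ^ n - 1" by blast
    have "n < (2::nat) ^ n" by (rule less_exp)
    then have nN: "n < N" using n that by linarith
    have "(\<Sum>k<N. fps_nth (fps_X ^ (2 ^ k - 1) :: 'a fps) i) =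
            (\<Sum>k<N. if k = n then 1 else 0)"
    proof (rule sum.cong[OF refl])
      fix k
      show "fps_nth (fps_X ^ (2 ^ k - 1) :: 'a fps) i = (if k = n then 1 else 0)"
        unfolding fps_X_power_nth n using inj[of n k] by (cases "k = n") auto
    qed
    also have "\<dots> = 1" using nN by simp
    finally show ?thesis using True by simp
  next
    case False
    then have "(\<Sum>k<N. fps_nth (fps_X ^ (2 ^ k - 1) :: 'a fps) i) = 0"
      unfolding fps_X_power_nth by (intro sum.neutral) metis
    then show ?thesis using False by simp
  qed
  then show "\<forall>\<^sub>F N in sequentially. fps_nth (\<Sum>n<N. fps_X ^ (2 ^ n - 1) :: 'a fps) i =
      fps_nth (Abs_fps (\<lambda>i. if \<exists>n. i = 2 ^ n - 1 then 1 else 0)) i"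
    by (intro eventually_mono[OF eventually_gt_at_top[of i]]) (simp add: fps_sum_nth)
qed

lemma r_series_sums: "(\<lambda>n. fps_X ^ (2 ^ n - 1)) sums r_series"
  unfolding r_series_def by (rule summable_sums[OF sums_summable[OF r_series_sums_aux]])

lemma r_series_nth: "fps_nth r_series i = (if \<exists>n. i = 2 ^ n - 1 then 1 else 0)"
  unfolding r_series_def sums_unique[OF r_series_sums_aux, symmetric] by (rule fps_nth_Abs_fps)

definition B_series :: "'a::field_char_0 fps" where
  "B_series = 1 - fps_X * r_series"

definition h :: "nat \<Rightarrow> 'a::field_char_0" where
  "h n = hankel_det n B_series"

definition g :: "nat \<Rightarrow> 'a::field_char_0" where
  "g n = hankel_det n ((1 - r_series) / fps_X)"

lemma one_minus_r_series_div_X: "fps_X * ((1 - r_series) / fps_X) = 1 - (r_series :: 'a::field_char_0 fps)"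
proof -
  have "fps_nth (r_series :: 'a fps) 0 = 1"
  proof -
    have "\<exists>n. (0::nat) = 2 ^ n - 1" by (rule exI[of _ 0]) simp
    then show ?thesis unfolding r_series_nth by (rule if_P)
  qed
  then have "fps_nth (1 - r_series :: 'a fps) 0 = 0" by simp
  moreover have "fps_nth ((1 - r_series :: 'a fps) / fps_X) i = fps_nth (1 - r_series) (i + 1)" for i
    using fps_div_fps_X_power_nth[of "1 - r_series :: 'a fps" 1 i] by simp
  ultimately show ?thesis
    by (intro fps_ext) (simp only: fps_X_mult_nth, simp)
qed

end

theory Submission
  imports Defs
begin

text \<open>
  Write \<open>n = m + 2 s + 1\<close> and \<open>2 ^ k = m + s\<close>. Split the Hankel matrix after its first \<open>m\<close> rows
  and columns. The antidiagonal of the lower right block \<open>S\<close>, of size \<open>2 s + 1\<close>, has index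
  sum \<open>2 ^ (k + 1)\<close>, so its entries are \<open>-1\<close>, and the entries of \<open>S\<close> below it are \<open>0\<close>. The matrix
  rows \<open>2 ^ k, \<dots>, n - 1\<close> have no other nonzero entry in the columns of \<open>S\<close> and therefore
  clear the upper right block. This adds \<open>1\<close> to the corner of the upper left block, and expanding
  along the first row gives \<open>h m + g (m - 1)\<close>.
\<close>

text \<open>\<open>X\<close> plays the role of \<open>- C * S^(-1)\<close>: left multiplication by
  the unipotent block matrix \<open>?U\<close> adds \<open>X\<close> times the lower block row to
  the upper one and so clears \<open>C\<close>.\<close>

lemma det_schur_upper_right:
  fixes A :: "'a :: idom mat"
  assumes A: "A \<in> carrier_mat m m" and C: "C \<in> carrier_mat m q"
    and D: "D \<in> carrier_mat q m" and S: "S \<in> carrier_mat q q"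
    and X: "X \<in> carrier_mat m q" and XS: "C + X * S = 0\<^sub>m m q"
  shows "det (four_block_mat A C D S) = det (A + X * D) * det S"
proof -
  let ?M = "four_block_mat A C D S"
  let ?U = "four_block_mat (1\<^sub>m m) X (0\<^sub>m q m) (1\<^sub>m q)"
  have "?U * ?M = four_block_mat (A + X * D) (0\<^sub>m m q) D S"
    using A C D S X XS by (subst mult_four_block_mat[of _ m m _ q _ q]) auto
  moreover have "det ?U = 1"
    using X by (subst det_four_block_mat_lower_left_zero[of _ m _ q]) auto
  moreover have "det (?U * ?M) = det ?U * det ?M"
    by (rule det_mult[of _ "m + q"]) (use A S in auto)
  moreover have "det (four_block_mat (A + X * D) (0\<^sub>m m q) D S) = det (A + X * D) * det S"
    using A D S X by (subst det_four_block_mat_upper_right_zero[of _ m _ q]) auto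
  ultimately show ?thesis by simp
qed

text \<open>All entries below the antidiagonal vanish, so the last row has only its entry in column
  \<open>0\<close>. Expanding along it leaves the Hankel matrix of \<open>fps_shift 1 f\<close>; the
  signs multiply to that of the order-reversing permutation.\<close>

lemma hankel_det_antitriangular:
  fixes f :: "'a::comm_ring_1 fps"
  assumes "\<And>i. q \<le> i \<Longrightarrow> i < 2 * q - 1 \<Longrightarrow> fps_nth f i = 0"
  shows "hankel_det q f = (-1) ^ (q * (q - 1) div 2) * fps_nth f (q - 1) ^ q"
  using assms
proof (induction q arbitrary: f)
  case 0
  then show ?case by (simp add: hankel_det_0)
next
  case (Suc q)
  let ?A = "mat (Suc q) (Suc q) (\<lambda>(i, j). fps_nth f (i + j))"
  have "hankel_det (Suc q) f = (\<Sum>j<Suc q. ?A $$ (q, j) * cofactor ?A q j)"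
    unfolding hankel_det_def by (rule laplace_expansion_row[of _ "Suc q"]) auto
  also have "\<dots> = (\<Sum>j<Suc q. if j = 0 then fps_nth f q * cofactor ?A q 0 else 0)"
    by (intro sum.cong) (auto simp: Suc.prems)
  also have "\<dots> = fps_nth f q * cofactor ?A q 0" by simp
  also have "cofactor ?A q 0 = (-1) ^ q * det (mat_delete ?A q 0)"
    by (simp add: cofactor_def)
  also have "mat_delete ?A q 0 = mat q q (\<lambda>(i, j). fps_nth (fps_shift 1 f) (i + j))"
    by (intro eq_matI) (auto simp: mat_delete_def)
  also have "det \<dots> = hankel_det q (fps_shift 1 f)"
    by (simp add: hankel_det_def)
  also have "\<dots> = (-1) ^ (q * (q - 1) div 2) * fps_nth f q ^ q"
  \<comment> \<open>The induction hypothesis yields the coefficient of \<open>f\<close> at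
    \<open>(q - 1) + 1\<close>, which is \<open>q\<close> only for \<open>q > 0\<close>.\<close>
  proof (cases "q = 0")
    case False
    then show ?thesis by (subst Suc.IH) (auto intro!: Suc.prems)
  qed (simp add: hankel_det_0)
  finally have "hankel_det (Suc q) f =
      (-1) ^ (q + q * (q - 1) div 2) * fps_nth f q ^ Suc q"
    by (simp add: power_add mult_ac)
  also have "q + q * (q - 1) div 2 = Suc q * (Suc q - 1) div 2"
    by (cases q) auto
  finally show ?case by simp
qed

text \<open>By linearity in the first row the added \<open>1\<close> contributes the corner
  cofactor; deleting the first row and column raises each index sum by 2.\<close>

lemma det_hankel_corner_add_one:
  fixes f :: "'a::comm_ring_1 fps"
  assumes "0 < m"
  shows "det (mat m m (\<lambda>(i, j). fps_nth f (i + j) + (if i = 0 \<and> j = 0 then 1 else 0))) =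
    hankel_det m f + hankel_det (m - 1) (fps_shift 2 f)"
proof -
  let ?H = "mat m m (\<lambda>(i, j). fps_nth f (i + j))"
  let ?M = "mat m m (\<lambda>(i, j). fps_nth f (i + j) + (if i = 0 \<and> j = 0 then 1 else 0))"
  have cof: "cofactor ?M 0 j = cofactor ?H 0 j" for j
  proof -
    have "mat_delete ?M 0 j = mat_delete ?H 0 j"
      by (intro eq_matI) (auto simp: mat_delete_def)
    then show ?thesis by (simp add: cofactor_def)
  qed
  have del: "mat_delete ?H 0 0 =
      mat (m - 1) (m - 1) (\<lambda>(i, j). fps_nth (fps_shift 2 f) (i + j))"
    by (intro eq_matI) (auto simp: mat_delete_def)
  have "det ?M = (\<Sum>j<m. ?M $$ (0, j) * cofactor ?M 0 j)"
    by (rule laplace_expansion_row[of _ m]) (use assms in auto)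
  also have "\<dots> = (\<Sum>j<m. ?H $$ (0, j) * cofactor ?H 0 j + (if j = 0 then cofactor ?H 0 0 else 0))"
    unfolding cof using assms by (intro sum.cong) (auto simp: algebra_simps)
  also have "\<dots> = (\<Sum>j<m. ?H $$ (0, j) * cofactor ?H 0 j) + cofactor ?H 0 0"
    using assms by (simp only: sum.distrib) simp
  also have "(\<Sum>j<m. ?H $$ (0, j) * cofactor ?H 0 j) = det ?H"
    by (rule laplace_expansion_row[symmetric, of _ m]) (use assms in auto)
  finally show ?thesis
    by (simp add: hankel_det_def cofactor_def del)
qed

lemma B_series_nth:
  "fps_nth B_series i = (if i = 0 then 1 else if \<exists>p. i = 2 ^ p then -1 else 0)"
proof (cases i)
  case (Suc j)
  have "j = 2 ^ p - 1 \<longleftrightarrow> Suc j = 2 ^ p" for p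
    using zero_less_power[of "2::nat" p] by linarith
  then show ?thesis
    using Suc by (simp add: B_series_def r_series_nth)
qed (simp add: B_series_def)

lemma B_series_nth_pow2 [simp]: "fps_nth B_series (2 ^ k) = -1"
  by (auto simp: B_series_nth)

lemma B_series_nth_between:
  assumes "2 ^ k < i" "i < 2 ^ Suc k"
  shows "fps_nth B_series i = 0"
proof -
  have "i \<noteq> 2 ^ p" for p
    using assms power_strict_increasing_iff[of "2::nat" k p]
      power_strict_increasing_iff[of "2::nat" p "Suc k"] by fastforce
  then show ?thesis using assms by (auto simp: B_series_nth)
qed

text \<open>\<open>B = 1 - x + x^2 * ((1 - r) / x)\<close>, so dropping two coefficients of
  \<open>B\<close> leaves the series of \<open>g\<close>.\<close>

lemma g_eq_hankel_det_shift:
  "(g n :: 'a::field_char_0) = hankel_det n (fps_shift 2 B_series)"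
proof -
  have "fps_nth ((1 - r_series) / fps_X) i = fps_nth (fps_shift 2 B_series :: 'a fps) i" for i
  proof -
    have "fps_nth (fps_X * ((1 - r_series) / fps_X)) (Suc i) = fps_nth (1 - r_series :: 'a fps) (Suc i)"
      by (simp only: one_minus_r_series_div_X)
    then show ?thesis by (simp add: B_series_def)
  qed
  then show ?thesis
    unfolding g_def by (metis fps_ext)
qed

text \<open>The sign is in terms of \<open>s\<close>, so that \<open>k = 0\<close> is covered too
  and gives \<open>h 2\<close>.\<close>

lemma h_split:
  fixes m s k :: nat
  assumes m: "0 < m" and K: "m + s = 2 ^ k"
  shows "(h (m + (2 * s + 1)) :: 'a::field_char_0) = (-1) ^ (s + 1) * (h m + g (m - 1))"
proof -
  let ?q = "2 * s + 1"
  let ?b = "fps_nth (B_series :: 'a fps)"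
  define A where "A = mat m m (\<lambda>(i, j). ?b (i + j))"
  define C where "C = mat m ?q (\<lambda>(i, j). ?b (i + (m + j)))"
  define D where "D = mat ?q m (\<lambda>(i, j). ?b (m + i + j))"
  define S where "S = mat ?q ?q (\<lambda>(i, j). ?b (m + i + (m + j)))"
  \<comment> \<open>Row \<open>c\<close> of \<open>S\<close> clears column
    \<open>b = 2 * s - c\<close> of \<open>C\<close>. Its pivot is \<open>-1\<close>, so its
    coefficient is the entry of \<open>C\<close> itself.\<close>
  define X where "X = mat m ?q (\<lambda>(i, j). if s \<le> j then ?b (i + (m + 2 * s - j)) else 0)"
  have K2: "2 * m + 2 * s = 2 ^ Suc k" using K by simp
  have bK: "?b (m + s) = -1" and bK2: "?b (2 * m + 2 * s) = -1"
    by (simp_all only: K K2 B_series_nth_pow2)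
  have b0: "?b i = 0" if "m + s < i" "i < 2 * m + 2 * s" for i
    using that B_series_nth_between[of k i] K K2 by simp
  have b1: "?b i = 0" if "2 * m + 2 * s < i" "i < 4 * m + 4 * s" for i
    using that B_series_nth_between[of "Suc k" i] K K2 by simp
  have "C + X * S = 0\<^sub>m m ?q"
  proof (rule eq_matI)
    fix a b assume "a < dim_row (0\<^sub>m m ?q :: 'a mat)" "b < dim_col (0\<^sub>m m ?q :: 'a mat)"
    then have a: "a < m" and b: "b < ?q" by auto
    have "(X * S) $$ (a, b) =
        (\<Sum>c<?q. (if s \<le> c then ?b (a + (m + 2 * s - c)) else 0) * ?b (m + c + (m + b)))"
      using a b by (simp add: X_def S_def scalar_prod_def lessThan_atLeast0)
    \<comment> \<open>For \<open>s \<le> c\<close> the index sum lies strictly between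
      \<open>2 ^ k\<close> and \<open>2 ^ (k + 2)\<close>, where the only nonzero coefficient is at
      \<open>2 ^ (k + 1)\<close>, that is, at \<open>c = 2 * s - b\<close>.\<close>
    also have "\<dots> = (\<Sum>c<?q. if c = 2 * s - b then (if b \<le> s then - ?b (a + (m + b)) else 0) else 0)"
    proof (rule sum.cong[OF refl])
      fix c assume "c \<in> {..<?q}"
      then have c: "c < ?q" by simp
      show "(if s \<le> c then ?b (a + (m + 2 * s - c)) else 0) * ?b (m + c + (m + b)) =
          (if c = 2 * s - b then (if b \<le> s then - ?b (a + (m + b)) else 0) else 0)"
      proof (cases "c = 2 * s - b")
        case True
        then have "m + c + (m + b) = 2 * m + 2 * s" "m + 2 * s - c = m + b" "s \<le> c \<longleftrightarrow> b \<le> s"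
          using b by auto
        then show ?thesis using True bK2 by simp
      next
        case False
        have "?b (m + c + (m + b)) = 0" if "s \<le> c"
        proof (cases "c + b < 2 * s")
          case True
          then show ?thesis using that m by (intro b0) auto
        next
          case nl: False
          then show ?thesis using False b c m by (intro b1) auto
        qed
        then show ?thesis using False by simp
      qed
    qed
    also have "\<dots> = (if b \<le> s then - ?b (a + (m + b)) else 0)"
      by simp
    also have "\<dots> = - ?b (a + (m + b))"
      \<comment> \<open>For \<open>b > s\<close> the index lies strictly between
        \<open>2 ^ k\<close> and \<open>2 ^ (k + 1)\<close>, so this entry of \<open>C\<close> is
        already \<open>0\<close>.\<close>
      using a b b0[of "a + (m + b)"] by auto
    finally show "(C + X * S) $$ (a, b) = 0\<^sub>m m ?q $$ (a, b)"
      using a b by (simp add: C_def X_def S_def)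
  qed (simp_all add: C_def X_def S_def)
  then have "det (four_block_mat A C D S) = det (A + X * D) * det S"
    by (intro det_schur_upper_right) (simp_all add: A_def C_def D_def S_def X_def)
  moreover have "mat (m + ?q) (m + ?q) (\<lambda>(i, j). ?b (i + j)) = four_block_mat A C D S"
    by (rule eq_matI) (auto simp: A_def C_def D_def S_def)
  moreover have "A + X * D =
      mat m m (\<lambda>(i, j). ?b (i + j) + (if i = 0 \<and> j = 0 then 1 else 0))"
  proof (rule eq_matI)
    fix a b
    assume "a < dim_row (mat m m (\<lambda>(i, j). ?b (i + j) + (if i = 0 \<and> j = 0 then 1 else 0)))"
      "b < dim_col (mat m m (\<lambda>(i, j). ?b (i + j) + (if i = 0 \<and> j = 0 then 1 else 0)))"
    then have a: "a < m" and b: "b < m" by auto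
    have "(X * D) $$ (a, b) =
        (\<Sum>c<?q. (if s \<le> c then ?b (a + (m + 2 * s - c)) else 0) * ?b (m + c + b))"
      using a b by (simp add: X_def D_def scalar_prod_def lessThan_atLeast0)
    also have "\<dots> = (\<Sum>c<?q. if c = s then (if a = 0 \<and> b = 0 then 1 else 0) else 0)"
    proof (rule sum.cong[OF refl])
      fix c assume "c \<in> {..<?q}"
      then have c: "c < ?q" by simp
      \<comment> \<open>With \<open>s \<le> c\<close> the factor from \<open>D\<close> has index
        from \<open>2 ^ k\<close> to below \<open>2 ^ (k + 1)\<close>, which forces
        \<open>c = s\<close> and \<open>b = 0\<close>; the factor from \<open>X\<close> then forces
        \<open>a = 0\<close>. The corner receives \<open>(-1) * (-1) = 1\<close>.\<close>
      have "?b (a + (m + s)) = 0" if "a \<noteq> 0"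
        using that a by (intro b0) auto
      moreover have "?b (m + c + b) = 0" if "s \<le> c" "c \<noteq> s \<or> b \<noteq> 0"
        using that b c by (intro b0) auto
      ultimately show "(if s \<le> c then ?b (a + (m + 2 * s - c)) else 0) * ?b (m + c + b) =
          (if c = s then (if a = 0 \<and> b = 0 then 1 else 0) else 0)"
        using bK by (auto simp: add_ac)
    qed
    also have "\<dots> = (if a = 0 \<and> b = 0 then 1 else 0)" by simp
    finally show "(A + X * D) $$ (a, b) =
        mat m m (\<lambda>(i, j). ?b (i + j) + (if i = 0 \<and> j = 0 then 1 else 0)) $$ (a, b)"
      using a b by (simp add: A_def X_def D_def)
  qed (simp_all add: A_def X_def D_def)
  moreover have "det S = (-1) ^ (s + 1)"
  proof -
    have "S = mat ?q ?q (\<lambda>(i, j). fps_nth (fps_shift (2 * m) (B_series :: 'a fps)) (i + j))"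
      unfolding S_def by (rule eq_matI) (simp_all add: mult_2 add_ac)
    then have "det S = hankel_det ?q (fps_shift (2 * m) (B_series :: 'a fps))"
      by (simp add: hankel_det_def)
    also have "\<dots> = (-1) ^ (?q * (?q - 1) div 2) * ?b (2 * m + 2 * s) ^ ?q"
      by (subst hankel_det_antitriangular) (use m in \<open>auto intro!: b1 simp: add_ac\<close>)
    \<comment> \<open>The total exponent of \<open>-1\<close> is
      \<open>s * ?q + ?q = (s + 1) * ?q\<close>, and \<open>?q\<close> is odd.\<close>
    also have "?q * (?q - 1) div 2 = s * ?q" by simp
    also have "(-1) ^ (s * ?q) * ?b (2 * m + 2 * s) ^ ?q = (-1) ^ (s + 1)"
      unfolding bK2 by (simp add: minus_one_power_iff)
    finally show ?thesis .
  qed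
  ultimately show ?thesis
    using det_hankel_corner_add_one[OF m, of "B_series :: 'a fps"]
    by (simp add: h_def g_eq_hankel_det_shift hankel_det_def mult_ac)
qed

theorem theorem19:
  shows "(h 0 :: 'a::field_char_0) = 1 \<and> (h 1 :: 'a) = 1 \<and> (h 2 :: 'a) = -2 \<and>
    (\<forall>n k m :: nat. 3 \<le> n \<and> 2 ^ k < n \<and> n \<le> 2 ^ (k + 1) \<and> m = 2 ^ (k + 1) - n + 1 \<longrightarrow>
       (h n :: 'a) = (-1) ^ n * (h m + g (m - 1)))"
proof (intro conjI allI impI)
  show "(h 0 :: 'a) = 1" by (simp add: h_def hankel_det_0)
  show h1: "(h 1 :: 'a) = 1"
    by (simp add: h_def hankel_det_def det_single B_series_nth)
  \<comment> \<open>The case \<open>m = 1\<close>, \<open>s = 0\<close>, \<open>k = 0\<close>, with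
    \<open>g 0 = 1\<close> as an empty determinant.\<close>
  have "(h (1 + (2 * 0 + 1)) :: 'a) = (-1) ^ (0 + 1) * (h 1 + g (1 - 1))"
    by (rule h_split[of _ _ 0]) simp_all
  moreover have "1 + (2 * 0 + 1) = (2 :: nat)" by simp
  moreover have "(g (1 - 1) :: 'a) = 1" by (simp add: g_def hankel_det_0)
  ultimately show "(h 2 :: 'a) = -2" by (simp only: h1) simp
next
  fix n k m :: nat
  assume *: "3 \<le> n \<and> 2 ^ k < n \<and> n \<le> 2 ^ (k + 1) \<and> m = 2 ^ (k + 1) - n + 1"
  \<comment> \<open>This solves \<open>m + 2 * s + 1 = n\<close> and
    \<open>m + s = 2 ^ k\<close>.\<close>
  define s where "s = n - 1 - 2 ^ k"
  from * have "2 ^ k < n" "n \<le> 2 * 2 ^ k" "m = 2 * 2 ^ k - n + 1" by simp_all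
  then have n: "m + (2 * s + 1) = n" and K: "m + s = 2 ^ k" and n': "n = 2 ^ k + (s + 1)"
    and m: "0 < m"
    unfolding s_def by linarith+
  \<comment> \<open>Here \<open>3 \<le> n\<close> enters: \<open>2 ^ k\<close> is even, so
    \<open>n\<close> and \<open>s + 1\<close> have the same parity. For \<open>n = 2\<close> they do
    not.\<close>
  from * have "k \<noteq> 0" by (cases k) auto
  then have "(-1 :: 'a) ^ n = (-1) ^ (s + 1)"
    unfolding n' power_add[of _ "2 ^ k"] by simp
  then show "(h n :: 'a) = (-1) ^ n * (h m + g (m - 1))"
    using h_split[OF m K, where 'a = 'a] unfolding n by simp
qed

end
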